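(* Let $k$ be a field and let $Y$ be a finite-dimensional $k$-algebra (not necessarily associative and not necessarily unital). For $x\in Y$ let $L_x, R_x : Y\to Y$ be the $k$-linear maps $L_x(y)=xy$ and $R_x(y)=yx$. If $Y$ admits a nondegenerate $Y$-associative bilinear form $\cup: Y\times Y\to k$, then for every $x\in Y$ one has $$\operatorname{trace}(R_x)=\operatorname{trace}(L_x),$$ and moreover the same equality holds for all powers: for every $x\in Y$ and every integer $n\ge 1$, $$\operatorname{trace}(R_x^{\,n})=\operatorname{trace}(L_x^{\,n}).$$
   Context: A $k$-algebra here is a $k$-vector space $Y$ with a $k$-bilinear multiplication $Y\times Y\to Y$, $(a,b)\mapsto ab$; no associativity and no unit element are assumed. A bilinear form $\cup:Y\times Y\to k$ is called $Y$-associative if $\cup(ab,c)=\cup(a,bc)$ for all $a,b,c\in Y$; it is not assumed symmetric. It is nondegenerate if its matrix in a basis of $Y$ is invertible. *)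

theory Defs
  imports "Jordan_Normal_Form.Matrix"
begin

definition bilinear_map ::
    "('k::field \<Rightarrow> 'a::ab_group_add \<Rightarrow> 'a) \<Rightarrow> ('k \<Rightarrow> 'b::ab_group_add \<Rightarrow> 'b) \<Rightarrow> ('a \<Rightarrow> 'a \<Rightarrow> 'b) \<Rightarrow> bool"
  where "bilinear_map s t f \<longleftrightarrow>
    (\<forall>a. Vector_Spaces.linear s t (\<lambda>b. f a b)) \<and> (\<forall>b. Vector_Spaces.linear s t (\<lambda>a. f a b))"

locale finite_dimensional_algebra = vector_space scale
  for scale :: "'k::field \<Rightarrow> 'y::ab_group_add \<Rightarrow> 'y" +
  fixes mul :: "'y \<Rightarrow> 'y \<Rightarrow> 'y"
  assumes finite_dimensional: "\<exists>B. finite B \<and> span B = UNIV"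
    and bilinear_mult: "bilinear_map scale scale mul"

definition left_mult :: "('y \<Rightarrow> 'y \<Rightarrow> 'y) \<Rightarrow> 'y \<Rightarrow> 'y \<Rightarrow> 'y"
  where "left_mult mul x = (\<lambda>y. mul x y)"

definition right_mult :: "('y \<Rightarrow> 'y \<Rightarrow> 'y) \<Rightarrow> 'y \<Rightarrow> 'y \<Rightarrow> 'y"
  where "right_mult mul x = (\<lambda>y. mul y x)"

definition associative_form :: "('y \<Rightarrow> 'y \<Rightarrow> 'y) \<Rightarrow> ('y \<Rightarrow> 'y \<Rightarrow> 'k) \<Rightarrow> bool"
  where "associative_form mul cup \<longleftrightarrow> (\<forall>a b c. cup (mul a b) c = cup a (mul b c))"

definition form_matrix :: "('y \<Rightarrow> 'y \<Rightarrow> 'k) \<Rightarrow> 'y list \<Rightarrow> 'k mat"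
  where "form_matrix cup bs = mat (length bs) (length bs) (\<lambda>(i, j). cup (bs ! i) (bs ! j))"

definition ordered_basis :: "('k::field \<Rightarrow> 'y::ab_group_add \<Rightarrow> 'y) \<Rightarrow> 'y list \<Rightarrow> bool"
  where "ordered_basis scale bs \<longleftrightarrow>
    distinct bs \<and> \<not> module.dependent scale (set bs) \<and> module.span scale (set bs) = UNIV"

definition nondegenerate :: "('k::field \<Rightarrow> 'y::ab_group_add \<Rightarrow> 'y) \<Rightarrow> ('y \<Rightarrow> 'y \<Rightarrow> 'k) \<Rightarrow> bool"
  where "nondegenerate scale cup \<longleftrightarrow>
    (\<exists>bs. ordered_basis scale bs \<and> invertible_mat (form_matrix cup bs))"

definition endo_matrix :: "('k::field \<Rightarrow> 'y::ab_group_add \<Rightarrow> 'y) \<Rightarrow> 'y list \<Rightarrow> ('y \<Rightarrow> 'y) \<Rightarrow> 'k mat"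
  where "endo_matrix scale bs f =
    mat (length bs) (length bs)
      (\<lambda>(i, j). module.representation scale (set bs) (f (bs ! j)) (bs ! i))"

text \<open>For linear maps the trace does not depend on the chosen basis, by
  \<open>endo_trace_eq\<close> below; a basis exists by \<open>ordered_basis_exists\<close>.\<close>

definition endo_trace :: "('k::field \<Rightarrow> 'y::ab_group_add \<Rightarrow> 'y) \<Rightarrow> ('y \<Rightarrow> 'y) \<Rightarrow> 'k"
  where "endo_trace scale f =
    (let A = endo_matrix scale (SOME bs. ordered_basis scale bs) f in \<Sum>i<dim_row A. A $$ (i, i))"

context vector_space
begin

lemma trace_endo_matrix:
  assumes "ordered_basis scale bs"
  shows "(\<Sum>i<dim_row (endo_matrix scale bs f). endo_matrix scale bs f $$ (i, i))
    = (\<Sum>b\<in>set bs. representation (set bs) (f b) b)"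
proof -
  have "distinct bs" using assms by (simp add: ordered_basis_def)
  then show ?thesis
    by (simp add: endo_matrix_def sum.distinct_set_conv_list sum_list_sum_nth atLeast0LessThan)
qed

lemma representation_expand:
  assumes f: "Vector_Spaces.linear scale scale f"
    and B: "finite B" "independent B" "span B = UNIV"
    and C: "finite C" "independent C" "span C = UNIV"
  shows "representation B (f v) b =
    (\<Sum>c\<in>C. representation C v c * representation B (f c) b)"
proof -
  interpret f: Vector_Spaces.linear scale scale f by fact
  have "v = (\<Sum>c\<in>C. representation C v c *s c)"
    using sum_representation_eq[OF C(2) _ C(1) order_refl, of v] C by simp
  then have "f v = (\<Sum>c\<in>C. representation C v c *s f c)"
    by (metis (mono_tags, lifting) f.sum f.scale sum.cong)
  then have "representation B (f v) b = representation B (\<Sum>c\<in>C. representation C v c *s f c) b"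
    by simp
  also have "\<dots> = (\<Sum>c\<in>C. representation B (representation C v c *s f c) b)"
    using B by (subst representation_sum) auto
  also have "\<dots> = (\<Sum>c\<in>C. representation C v c * representation B (f c) b)"
    using B by (intro sum.cong refl) (subst representation_scale, auto)
  finally show ?thesis .
qed

theorem endo_trace_eq:
  assumes f: "Vector_Spaces.linear scale scale f" and bs: "ordered_basis scale bs"
  shows "endo_trace scale f =
    (\<Sum>i<length bs. endo_matrix scale bs f $$ (i, i))"
proof -
  define cs where "cs = (SOME bs. ordered_basis scale bs)"
  have cs: "ordered_basis scale cs" unfolding cs_def using bs by (rule someI)
  define B where "B = set bs"
  define C where "C = set cs"
  have B: "finite B" "independent B" "span B = UNIV"
    and C: "finite C" "independent C" "span C = UNIV"
    using bs cs by (auto simp: B_def C_def ordered_basis_def)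
  have id: "Vector_Spaces.linear scale scale (\<lambda>x. x)" by (rule linear_ident)
  let ?B = "representation B" and ?C = "representation C"
  have "(\<Sum>b\<in>B. ?B (f b) b) = (\<Sum>b\<in>B. \<Sum>c\<in>C. ?C b c * ?B (f c) b)"
    by (intro sum.cong refl representation_expand f B C)
  also have "\<dots> = (\<Sum>c\<in>C. \<Sum>b\<in>B. ?B (f c) b * ?C b c)"
    by (subst sum.swap) (simp add: mult.commute)
  also have "\<dots> = (\<Sum>c\<in>C. ?C (f c) c)"
    by (intro sum.cong refl representation_expand[OF id C B, symmetric])
  finally show ?thesis
    using trace_endo_matrix[OF bs, of f] trace_endo_matrix[OF cs, of f]
    by (simp add: endo_trace_def cs_def[symmetric] B_def C_def endo_matrix_def)
qed

end

lemma (in finite_dimensional_algebra) ordered_basis_exists: "\<exists>bs. ordered_basis scale bs"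
proof -
  obtain S where S: "finite S" "span S = UNIV" using finite_dimensional by blast
  obtain B where B: "B \<subseteq> S" "independent B" "S \<subseteq> span B"
    using maximal_independent_subset[of S] by metis
  have "finite B" using B S finite_subset by blast
  then obtain bs where "set bs = B" "distinct bs" using finite_distinct_list by blast
  moreover have "span B = UNIV" using span_minimal[OF B(3)] S by auto
  ultimately show ?thesis using B(2) unfolding ordered_basis_def by blast
qed

end

theory Submission
  imports Defs
begin

text \<open>Associativity of the form says \<open>cup (R\<^sub>x a) c = cup a (L\<^sub>x c)\<close>, so \<open>R\<^sub>x\<close> and \<open>L\<^sub>x\<close>, and hence
  their \<open>n\<close>-th powers, are adjoint with respect to \<open>cup\<close>. In a basis with invertible Gram matrix
  \<open>G\<close> this reads \<open>F\<^sup>T G = G H\<close>, so \<open>F\<^sup>T\<close> is conjugate to \<open>H\<close> and the traces agree.\<close>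

lemma trace_mult_commute:
  fixes A B :: "'a::comm_semiring_0 mat"
  assumes A: "A \<in> carrier_mat n m" and B: "B \<in> carrier_mat m n"
  shows "(\<Sum>i<n. (A * B) $$ (i, i)) = (\<Sum>i<m. (B * A) $$ (i, i))"
proof -
  have "(\<Sum>i<n. (A * B) $$ (i, i)) = (\<Sum>i<n. \<Sum>j<m. A $$ (i, j) * B $$ (j, i))"
    using A B by (simp add: scalar_prod_def atLeast0LessThan)
  also have "\<dots> = (\<Sum>j<m. \<Sum>i<n. B $$ (j, i) * A $$ (i, j))"
    by (subst sum.swap) (simp add: mult.commute)
  also have "\<dots> = (\<Sum>i<m. (B * A) $$ (i, i))"
    using A B by (simp add: scalar_prod_def atLeast0LessThan)
  finally show ?thesis .
qed

text \<open>Invertibility of \<open>G\<close> turns \<open>eq\<close> into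
  \<open>F = G * H * G'\<close> with \<open>G'\<close> the inverse; cyclicity of the trace then
  moves \<open>G'\<close> to the front, where it cancels \<open>G\<close>.\<close>

lemma trace_eq_of_intertwining:
  fixes F G H :: "'a::comm_ring_1 mat"
  assumes F: "F \<in> carrier_mat n n" and G: "G \<in> carrier_mat n n" and H: "H \<in> carrier_mat n n"
    and inv: "invertible_mat G" and eq: "F * G = G * H"
  shows "(\<Sum>i<n. F $$ (i, i)) = (\<Sum>i<n. H $$ (i, i))"
proof -
  obtain G' where G': "G * G' = 1\<^sub>m n" "G' * G = 1\<^sub>m (dim_row G')"
    using inv G by (auto simp: invertible_mat_def inverts_mat_def)
  \<comment> \<open>The column count of \<open>G'\<close> is read off \<open>G * G'\<close>, its row
    count off \<open>G' * G\<close>.\<close>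
  have dims: "G' \<in> carrier_mat n n"
    using G G' by (metis carrier_matD(2) carrier_matI index_mult_mat(3) index_one_mat(3))
  have "F = F * (G * G')" using F G' by simp
  also have "\<dots> = F * G * G'" using F G dims by simp
  also have "\<dots> = G * H * G'" by (simp add: eq)
  finally have "(\<Sum>i<n. F $$ (i, i)) = (\<Sum>i<n. (G * H * G') $$ (i, i))" by simp
  also have "\<dots> = (\<Sum>i<n. (G' * (G * H)) $$ (i, i))"
    using G H dims by (intro trace_mult_commute[where m = n]) auto
  also have "G' * (G * H) = G' * G * H" using G H dims by simp
  also have "\<dots> = H" using G' H dims by simp
  finally show ?thesis .
qed

context vector_space
begin

text \<open>The target scaling \<open>t\<close> is kept general to cover linear functionals, namely
  \<open>cup\<close> with one argument fixed, where \<open>t\<close> is multiplication in the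
  field.\<close>

lemma linear_apply_basis:
  assumes h: "Vector_Spaces.linear scale t h" and bs: "ordered_basis scale bs"
  shows "h v = (\<Sum>i<length bs. t (representation (set bs) v (bs ! i)) (h (bs ! i)))"
proof -
  interpret h: Vector_Spaces.linear scale t h by fact
  have "v = (\<Sum>b\<in>set bs. representation (set bs) v b *s b)"
    using bs by (subst sum_representation_eq) (auto simp: ordered_basis_def)
  then have "h v = (\<Sum>b\<in>set bs. t (representation (set bs) v b) (h b))"
    by (metis (mono_tags, lifting) h.sum h.scale sum.cong)
  also have "\<dots> = (\<Sum>i<length bs. t (representation (set bs) v (bs ! i)) (h (bs ! i)))"
    using bs by (simp add: ordered_basis_def sum.distinct_set_conv_list sum_list_sum_nth
        atLeast0LessThan)
  finally show ?thesis .
qed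

lemma endo_trace_adjoint_eq:
  assumes f: "Vector_Spaces.linear scale scale f" and g: "Vector_Spaces.linear scale scale g"
    and cup: "bilinear_map scale (*) cup" and nondeg: "nondegenerate scale cup"
    and adj: "\<And>a c. cup (f a) c = cup a (g c)"
  shows "endo_trace scale f = endo_trace scale g"
proof -
  obtain bs where bs: "ordered_basis scale bs" and inv: "invertible_mat (form_matrix cup bs)"
    using nondeg by (auto simp: nondegenerate_def)
  define n where "n = length bs"
  let ?F = "endo_matrix scale bs f" and ?H = "endo_matrix scale bs g"
    and ?G = "form_matrix cup bs"
  have F: "?F \<in> carrier_mat n n" and G: "?G \<in> carrier_mat n n" and H: "?H \<in> carrier_mat n n"
    by (simp_all add: endo_matrix_def form_matrix_def n_def)
  have "?F\<^sup>T * ?G = ?G * ?H"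
  proof (rule eq_matI)
    fix j k assume "j < dim_row (?G * ?H)" "k < dim_col (?G * ?H)"
    then have jk: "j < n" "k < n" using G H by auto
    \<comment> \<open>Column \<open>j\<close> of \<open>?F\<close> holds the coordinates of
      \<open>f (bs ! j)\<close>, so this is the expansion of the first argument of
      \<open>cup\<close>. The product with \<open>?H\<close> below expands the second argument, so
      symmetry of \<open>cup\<close> never enters.\<close>
    have "(?F\<^sup>T * ?G) $$ (j, k) = cup (f (bs ! j)) (bs ! k)"
      using jk linear_apply_basis[OF _ bs, of "(*)" "\<lambda>a. cup a (bs ! k)" "f (bs ! j)"] cup
      by (simp add: bilinear_map_def scalar_prod_def endo_matrix_def form_matrix_def
          n_def atLeast0LessThan)
    also have "\<dots> = cup (bs ! j) (g (bs ! k))" by (rule adj)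
    also have "\<dots> = (?G * ?H) $$ (j, k)"
      using jk linear_apply_basis[OF _ bs, of "(*)" "cup (bs ! j)" "g (bs ! k)"] cup
      by (simp add: bilinear_map_def scalar_prod_def endo_matrix_def form_matrix_def
          n_def atLeast0LessThan mult.commute)
    finally show "(?F\<^sup>T * ?G) $$ (j, k) = (?G * ?H) $$ (j, k)" .
  qed (use F G H in auto)
  then have "(\<Sum>i<n. ?F\<^sup>T $$ (i, i)) = (\<Sum>i<n. ?H $$ (i, i))"
    using F G H inv by (intro trace_eq_of_intertwining[of _ n ?G]) auto
  \<comment> \<open>Transposing preserves the diagonal, and \<open>endo_trace_eq\<close> allows both
    traces to be computed in the basis supplied by nondegeneracy.\<close>
  then show ?thesis
    using F by (simp add: endo_trace_eq[OF f bs] endo_trace_eq[OF g bs] n_def)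
qed

lemma linear_funpow:
  assumes "Vector_Spaces.linear scale scale f"
  shows "Vector_Spaces.linear scale scale (f ^^ n)"
proof (induction n)
  case 0
  show ?case by (simp add: id_def linear_ident)
next
  case (Suc n)
  then show ?case using Vector_Spaces.linear_compose[OF Suc.IH assms] by (simp add: o_def)
qed

end

text \<open>The outermost \<open>f\<close> crosses \<open>cup\<close> and turns \<open>c\<close>
  into \<open>g c\<close>, so the induction needs \<open>c\<close> arbitrary.\<close>

lemma funpow_adjoint:
  assumes "\<And>a c. cup (f a) c = cup a (g c)"
  shows "cup ((f ^^ n) a) c = cup a ((g ^^ n) c)"
  by (induction n arbitrary: c) (simp_all add: assms funpow_swap1[of g])

theorem theorem3p2:
  fixes scale :: "'k::field \<Rightarrow> 'y::ab_group_add \<Rightarrow> 'y"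
    and mul :: "'y \<Rightarrow> 'y \<Rightarrow> 'y"
  assumes "finite_dimensional_algebra scale mul"
    and "\<exists>cup. bilinear_map scale (*) cup \<and> associative_form mul cup
           \<and> nondegenerate scale cup"
  shows "(\<forall>x. endo_trace scale (right_mult mul x)
            = endo_trace scale (left_mult mul x)) \<and>
         (\<forall>x. \<forall>n::nat. n \<ge> 1 \<longrightarrow>
            endo_trace scale (right_mult mul x ^^ n)
            = endo_trace scale (left_mult mul x ^^ n))"
proof -
  interpret finite_dimensional_algebra scale mul by fact
  obtain cup where cup: "bilinear_map scale (*) cup" "nondegenerate scale cup"
    and assoc: "associative_form mul cup"
    using assms(2) by blast
  have linear: "Vector_Spaces.linear scale scale (right_mult mul x)"
    "Vector_Spaces.linear scale scale (left_mult mul x)" for x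
    using bilinear_mult by (simp_all add: bilinear_map_def right_mult_def left_mult_def)
  have adj: "cup (right_mult mul x a) c = cup a (left_mult mul x c)" for x a c
    using assoc by (simp add: associative_form_def right_mult_def left_mult_def)
  have powers: "endo_trace scale (right_mult mul x ^^ n) = endo_trace scale (left_mult mul x ^^ n)"
    for x n
    by (intro endo_trace_adjoint_eq[OF _ _ cup] linear_funpow linear funpow_adjoint adj)
  \<comment> \<open>The first conjunct is the case of exponent 1.\<close>
  show ?thesis using powers powers[of 1] by simp
qed

end
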